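(* Let $G$ be a finite abelian group and $t$ an integer relatively prime to $|G|$. Let $X\in \mathbb{Z}[G]$ satisfy $X^{(t)}=X$, $|X|=n$ and $XX^{(-1)}=n^2$ for some integer $n\geq 1$, and let $a_0$ be the coefficient of the identity in $X$. Suppose that for every prime divisor $q$ of $|G|$ at least one of the following holds: (1) $\operatorname{ord}_q(t)>\max\{n,n-a_0\}$; (2) $\operatorname{ord}_q(t)\geq n$ and $\operatorname{ord}_q(t)$ is even. Then $X=n$.
   Context: For $X=\sum_g x_g g\in\mathbb{Z}[G]$ and an integer $s$, $X^{(s)}=\sum_g x_g g^s$ and $|X|=\sum_g x_g$. $\operatorname{ord}_q(t)$ is the multiplicative order of $t$ modulo $q$. *)

theory Defs
  imports "HOL-Algebra.Multiplicative_Group" "HOL-Number_Theory.Number_Theory"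
begin

text \<open>
  The integral group ring of a finite group \<open>G\<close>.  An element \<open>\<Sum>g. x\<^sub>g g\<close> is represented by its
  coefficient function \<open>g \<mapsto> x\<^sub>g\<close>, extended by \<open>0\<close> outside of the carrier so that equality in the
  ring is equality of functions.
\<close>

definition int_group_ring :: "('a, 'b) monoid_scheme \<Rightarrow> ('a \<Rightarrow> int) ring" where
  "int_group_ring G =
     \<lparr>carrier = {X. \<forall>g. g \<notin> carrier G \<longrightarrow> X g = 0},
      mult = (\<lambda>X Y g. if g \<in> carrier G
                then \<Sum>h\<in>carrier G. X h * Y (inv\<^bsub>G\<^esub> h \<otimes>\<^bsub>G\<^esub> g) else 0),
      one = (\<lambda>g. if g = \<one>\<^bsub>G\<^esub> then 1 else 0),
      zero = (\<lambda>g. 0),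
      add = (\<lambda>X Y g. X g + Y g)\<rparr>"

text \<open>The integer \<open>m\<close> regarded as an element of the group ring, i.e. \<open>m\<close> times the identity.\<close>

definition gr_of_int :: "('a, 'b) monoid_scheme \<Rightarrow> int \<Rightarrow> 'a \<Rightarrow> int" where
  "gr_of_int G m = (\<lambda>g. if g = \<one>\<^bsub>G\<^esub> then m else 0)"

text \<open>\<open>gr_power G s X = X\<^sup>(\<^sup>s\<^sup>) = \<Sum>h. x\<^sub>h h\<^sup>s\<close>: the coefficient of \<open>g\<close> collects all \<open>h\<close> with \<open>h\<^sup>s = g\<close>.\<close>

definition gr_power :: "('a, 'b) monoid_scheme \<Rightarrow> int \<Rightarrow> ('a \<Rightarrow> int) \<Rightarrow> 'a \<Rightarrow> int" where
  "gr_power G s X = (\<lambda>g. \<Sum>h | h \<in> carrier G \<and> h [^]\<^bsub>G\<^esub> s = g. X h)"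

definition gr_sum :: "('a, 'b) monoid_scheme \<Rightarrow> ('a \<Rightarrow> int) \<Rightarrow> int" where
  "gr_sum G X = (\<Sum>g\<in>carrier G. X g)"

lemma cring_int_group_ring:
  fixes G (structure)
  assumes "comm_group G" and fin: "finite (carrier G)"
  shows "cring (int_group_ring G)"
proof -
  interpret comm_group G by fact
  let ?c = "\<lambda>X Y g. \<Sum>h\<in>carrier G. X h * Y (inv h \<otimes> g) :: int"
  have canc: "x \<otimes> (inv x \<otimes> y) = y" "inv x \<otimes> (x \<otimes> y) = y"
    if "x \<in> carrier G" "y \<in> carrier G" for x y
    using that by (simp_all add: m_assoc[symmetric])
  have canc3: "inv (inv x \<otimes> y) \<otimes> y = x" if "x \<in> carrier G" "y \<in> carrier G" for x y
    using that by (simp add: inv_mult_group m_assoc m_comm[of x y] canc)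
  have sub: "(\<Sum>h\<in>carrier G. f (inv h \<otimes> g)) = (\<Sum>h\<in>carrier G. f h)"
    if "g \<in> carrier G" for f :: "'a \<Rightarrow> int" and g
    by (rule sum.reindex_bij_witness[of _ "\<lambda>h. g \<otimes> inv h" "\<lambda>h. inv h \<otimes> g"])
       (use that in \<open>auto simp: inv_mult_group m_assoc canc\<close>)
  have shift: "(\<Sum>h\<in>carrier G. f (inv g \<otimes> h)) = (\<Sum>h\<in>carrier G. f h)"
    if "g \<in> carrier G" for f :: "'a \<Rightarrow> int" and g
    by (rule sum.reindex_bij_witness[of _ "\<lambda>h. g \<otimes> h" "\<lambda>h. inv g \<otimes> h"])
       (use that in \<open>auto simp: canc\<close>)
  have comm: "?c X Y g = ?c Y X g" if g: "g \<in> carrier G" for X Y g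
  proof -
    have "?c Y X g = (\<Sum>h\<in>carrier G. Y (inv (inv h \<otimes> g) \<otimes> g) * X (inv h \<otimes> g))"
      by (intro sum.cong) (use g in \<open>simp_all add: canc3\<close>)
    also have "\<dots> = (\<Sum>h\<in>carrier G. Y (inv h \<otimes> g) * X h)"
      by (rule sub[OF g, of "\<lambda>h. Y (inv h \<otimes> g) * X h"])
    finally show ?thesis by (simp add: mult.commute)
  qed
  have assoc: "(\<Sum>k\<in>carrier G. ?c X Y k * Z (inv k \<otimes> g)) = (\<Sum>h\<in>carrier G. X h * ?c Y Z (inv h \<otimes> g))"
    if g: "g \<in> carrier G" for X Y Z g
  proof -
    have "(\<Sum>k\<in>carrier G. ?c X Y k * Z (inv k \<otimes> g))
        = (\<Sum>h\<in>carrier G. X h * (\<Sum>k\<in>carrier G. Y (inv h \<otimes> k) * Z (inv k \<otimes> g)))"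
      by (simp add: sum_distrib_left sum_distrib_right mult.assoc) (rule sum.swap)
    also have "\<dots> = (\<Sum>h\<in>carrier G. X h * ?c Y Z (inv h \<otimes> g))"
    proof (rule sum.cong[OF refl])
      fix h assume h: "h \<in> carrier G"
      have "(\<Sum>k\<in>carrier G. Y (inv h \<otimes> k) * Z (inv k \<otimes> g))
          = (\<Sum>k\<in>carrier G. Y (inv h \<otimes> k) * Z (inv (inv h \<otimes> k) \<otimes> (inv h \<otimes> g)))"
        by (intro sum.cong) (use g h in \<open>auto simp: inv_mult_group m_assoc canc\<close>)
      also have "\<dots> = ?c Y Z (inv h \<otimes> g)"
        by (rule shift[OF h, of "\<lambda>k. Y k * Z (inv k \<otimes> (inv h \<otimes> g))"])
      finally show "X h * (\<Sum>k\<in>carrier G. Y (inv h \<otimes> k) * Z (inv k \<otimes> g))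
          = X h * ?c Y Z (inv h \<otimes> g)" by (rule arg_cong)
    qed
    finally show ?thesis .
  qed
  show ?thesis
  proof (rule cringI)
    show "abelian_group (int_group_ring G)"
    proof (rule abelian_groupI)
      fix X assume "X \<in> carrier (int_group_ring G)"
      then show "\<exists>Y\<in>carrier (int_group_ring G). Y \<oplus>\<^bsub>int_group_ring G\<^esub> X = \<zero>\<^bsub>int_group_ring G\<^esub>"
        by (intro bexI[of _ "\<lambda>g. - X g"]) (auto simp: int_group_ring_def)
    qed (auto simp: int_group_ring_def add_ac)
    show "comm_monoid (int_group_ring G)"
    proof (rule comm_monoidI)
      fix X Y Z
      show "X \<otimes>\<^bsub>int_group_ring G\<^esub> Y \<otimes>\<^bsub>int_group_ring G\<^esub> Z
          = X \<otimes>\<^bsub>int_group_ring G\<^esub> (Y \<otimes>\<^bsub>int_group_ring G\<^esub> Z)"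
        by (auto simp: int_group_ring_def fun_eq_iff assoc cong: sum.cong)
      show "X \<otimes>\<^bsub>int_group_ring G\<^esub> Y = Y \<otimes>\<^bsub>int_group_ring G\<^esub> X"
        by (auto simp: int_group_ring_def fun_eq_iff intro: comm)
      assume "X \<in> carrier (int_group_ring G)"
      then show "\<one>\<^bsub>int_group_ring G\<^esub> \<otimes>\<^bsub>int_group_ring G\<^esub> X = X"
        by (auto simp: int_group_ring_def fun_eq_iff if_distrib[of "\<lambda>x. x * _"] fin cong: if_cong)
    qed (auto simp: int_group_ring_def)
    fix X Y Z
    show "(X \<oplus>\<^bsub>int_group_ring G\<^esub> Y) \<otimes>\<^bsub>int_group_ring G\<^esub> Z
        = X \<otimes>\<^bsub>int_group_ring G\<^esub> Z \<oplus>\<^bsub>int_group_ring G\<^esub> Y \<otimes>\<^bsub>int_group_ring G\<^esub> Z"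
      by (auto simp: int_group_ring_def fun_eq_iff algebra_simps sum.distrib)
  qed
qed

end

theory Submission
  imports Defs
begin

text \<open>
  Let \<open>f d\<close> be the coefficient of the identity in \<open>X\<^sup>(\<^sup>d\<^sup>)\<close>, i.e. the sum of the coefficients of \<open>X\<close> on
  the \<open>d\<close>-torsion of \<open>G\<close>.  Since \<open>X\<^sup>(\<^sup>d\<^sup>)\<close> inherits \<open>|X| = n\<close> and \<open>X X\<^sup>(\<^sup>-\<^sup>1\<^sup>) = n\<^sup>2\<close>, we have \<open>-n < f d \<le> n\<close>,
  with \<open>f d = n\<close> only if \<open>X\<^sup>(\<^sup>d\<^sup>) = n\<close>.  The orbits of \<open>g \<mapsto> g\<^sup>t\<close> on elements of order divisible by \<open>q\<close>
  have length divisible by \<open>ord\<^sub>q(t)\<close>, so \<open>f (c q) \<equiv> f c\<close> modulo \<open>ord\<^sub>q(t) \<ge> n\<close>.  If \<open>d > 1\<close> is minimal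
  with \<open>f d = n\<close>, these congruences and bounds force all \<open>ord\<^sub>q(t)\<close>, for \<open>q\<close> a prime factor of \<open>d\<close>, to
  equal \<open>n - f 1 = n - a\<^sub>0\<close>.  So (1) fails for such \<open>q\<close>, and \<open>n - a\<^sub>0\<close> is even by (2).

  To exclude this, put \<open>u = t\<^sup>k\<close> with \<open>k = |G| (n - a\<^sub>0) / 2\<close>; then \<open>u \<equiv> -1\<close> modulo the \<open>q\<close>-part of \<open>|G|\<close> for
  each such \<open>q\<close>.  For \<open>d\<^sub>0 = |G| / gcd(|G|, u + 1)\<close> the element \<open>Y = X\<^sup>(\<^sup>d\<^sup>0\<^sup>)\<close> satisfies \<open>Y\<^sup>(\<^sup>-\<^sup>1\<^sup>) = Y\<^sup>(\<^sup>u\<^sup>) = Y\<close>,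
  hence \<open>Y\<^sup>2 = n\<^sup>2\<close>.  As \<open>2n\<close> is prime to \<open>|G|\<close>, the Frobenius congruence yields \<open>Y = Y\<^sup>(\<^sup>q\<^sup>)\<close> for all primes
  \<open>q\<close> dividing \<open>|G|\<close>, so \<open>Y = Y\<^sup>(\<^sup>|\<^sup>G\<^sup>|\<^sup>) = n\<close> and \<open>f d\<^sub>0 = n\<close>.  A minimal divisor \<open>d\<close> of \<open>d\<^sub>0\<close> with \<open>f d = n\<close>
  therefore has no prime factor at all, and \<open>a\<^sub>0 = f 1 = n\<close>.
\<close>

section \<open>Integers modulo a prime\<close>

text \<open>Passing to the residue of \<open>t\<close> as a natural number makes
  \<open>ord_divides\<close> and \<open>order_divides_totient\<close> applicable.\<close>

lemma ord_int_eq_ord_nat: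
  assumes "q > 0"
  shows "ord (int q) t = ord q (nat (t mod int q))"
proof -
  define r where "r = nat (t mod int q)"
  have r: "int r = t mod int q"
    using assms by (simp add: r_def)
  have "coprime (int q) t \<longleftrightarrow> coprime (int q) (int r)"
    using assms by (simp add: r coprime_commute)
  moreover have "[t ^ d = 1] (mod int q) \<longleftrightarrow> [r ^ d = 1] (mod q)" for d
  proof -
    have "[t ^ d = 1] (mod int q) \<longleftrightarrow> [int r ^ d = 1] (mod int q)"
      by (simp add: r cong_def power_mod)
    also have "\<dots> \<longleftrightarrow> [r ^ d = 1] (mod q)"
      by (metis cong_int_iff of_nat_1 of_nat_power)
    finally show ?thesis .
  qed
  ultimately show ?thesis
    by (simp add: ord_def flip: r_def)
qed

lemma ord_int_divides:
  assumes "q > 0"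
  shows "[t ^ d = 1] (mod int q) \<longleftrightarrow> ord (int q) t dvd d"
proof -
  define r where "r = nat (t mod int q)"
  have r: "int r = t mod int q"
    using assms by (simp add: r_def)
  have "[t ^ d = 1] (mod int q) \<longleftrightarrow> [int r ^ d = 1] (mod int q)"
    by (simp add: r cong_def power_mod)
  also have "\<dots> \<longleftrightarrow> [r ^ d = 1] (mod q)"
    by (metis cong_int_iff of_nat_1 of_nat_power)
  also have "\<dots> \<longleftrightarrow> ord q r dvd d"
    by (rule ord_divides)
  finally show ?thesis
    using assms by (simp add: ord_int_eq_ord_nat r_def)
qed

lemma ord_int_pos:
  assumes "q > 0" "coprime (int q) t"
  shows "0 < ord (int q) t"
proof -
  have "coprime (int q) (int (nat (t mod int q)))"
    using assms by (simp add: coprime_commute)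
  then have "coprime q (nat (t mod int q))" by (simp only: coprime_int_iff)
  then show ?thesis using assms(1) by (simp add: ord_int_eq_ord_nat)
qed

lemma ord_int_less_prime:
  assumes "prime q" "coprime (int q) t"
  shows "ord (int q) t < q"
proof -
  have q: "q > 1" using assms(1) by (rule prime_gt_1_nat)
  then have "coprime q (nat (t mod int q))"
    using ord_int_pos[of q t] assms(2) by (simp add: ord_int_eq_ord_nat)
  then have "ord (int q) t dvd q - 1"
    using order_divides_totient[of q] q assms(1)
    by (simp add: ord_int_eq_ord_nat totient_prime)
  then have "ord (int q) t \<le> q - 1"
    using q by (intro dvd_imp_le) auto
  then show ?thesis using q by simp
qed

text \<open>Raising \<open>t\<close> to half its order gives a square root of 1 modulo
  \<open>q\<close>. It is not 1, as the exponent is below the order, so modulo a prime it is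
  -1.\<close>

lemma even_ord_imp_minus_one:
  assumes q: "prime q" and c: "coprime (int q) t" and ev: "even (ord (int q) t)"
  shows "int q dvd t ^ (ord (int q) t div 2) + 1"
proof -
  let ?m = "ord (int q) t"
  have q0: "q > 0" using q prime_gt_0_nat by blast
  have "[t ^ ?m = 1] (mod int q)"
    by (simp add: ord_int_divides[OF q0])
  moreover have "t ^ ?m = (t ^ (?m div 2))\<^sup>2"
    using ev by (simp flip: power_mult)
  ultimately have "int q dvd (t ^ (?m div 2) + 1) * (t ^ (?m div 2) - 1)"
    by (simp add: cong_iff_dvd_diff power2_eq_square algebra_simps)
  moreover have "\<not> int q dvd t ^ (?m div 2) - 1"
  proof
    assume "int q dvd t ^ (?m div 2) - 1"
    then have "?m dvd ?m div 2"
      by (simp add: ord_int_divides[OF q0, symmetric] cong_iff_dvd_diff)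
    moreover have "?m div 2 > 0"
      using ord_int_pos[OF q0 c] ev by (auto elim!: evenE)
    ultimately show False by (auto dest: dvd_imp_le)
  qed
  ultimately show ?thesis
    using q by (simp add: prime_dvd_mult_iff)
qed

lemma fermat_int:
  assumes "prime q"
  shows "int q dvd c ^ q - c"
proof (cases "int q dvd c")
  case True
  then show ?thesis
    using assms prime_gt_0_nat[of q] by (intro dvd_diff) (auto intro: dvd_power_le[of _ _ 1 q, simplified])
next
  case False
  then have "coprime c (int q)"
    using assms using prime_imp_coprime[of "int q" c] by (simp add: coprime_commute)
  moreover have "residues (int q)"
    using assms prime_gt_1_nat[of q] by (simp add: residues_def)
  ultimately have "[c ^ (q - 1) = 1] (mod int q)"
    using residues.euler_theorem[of "int q" c] assms by (simp add: totient_prime)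
  then have "[c * c ^ (q - 1) = c * 1] (mod int q)"
    by (rule cong_scalar_left)
  then show ?thesis
    using assms prime_gt_0_nat[of q]
    by (simp add: cong_iff_dvd_diff flip: power_Suc)
qed

text \<open>Each further \<open>q\<close>-th power gains a factor \<open>q\<close>: in the
  factorisation of \<open>z ^ q + 1\<close> by \<open>z + 1\<close>, the cofactor has
  \<open>q\<close> summands, each congruent to 1 modulo \<open>q\<close>.\<close>

lemma prime_power_dvd_lift:
  assumes q: "prime q" "odd q" and y: "int q dvd y + 1"
  shows "int (q ^ Suc j) dvd y ^ (q ^ j) + 1"
proof (induction j)
  case 0
  then show ?case using y by simp
next
  case (Suc j)
  define z where "z = y ^ (q ^ j)"
  have e: "z ^ q + 1 = (z + 1) * (\<Sum>i<q. z ^ i * (- 1) ^ (q - 1 - i))"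
    using power_diff_sumr2[of z q "-1"] q by (simp add: mult.commute)
  have "[z = -1] (mod int q)"
    using dvd_trans[OF _ Suc] by (simp add: cong_iff_dvd_diff z_def)
  have "[(\<Sum>i<q. z ^ i * (- 1) ^ (q - 1 - i)) = (\<Sum>i<q. (-1) ^ i * (- 1) ^ (q - 1 - i))] (mod int q)"
    by (intro cong_sum cong_mult cong_pow cong_refl \<open>[z = -1] (mod int q)\<close>)
  also have "(\<Sum>i<q. (-1) ^ i * (- 1) ^ (q - 1 - i)) = (\<Sum>i<q. 1 :: int)"
    using q by (intro sum.cong) (auto simp flip: power_add)
  finally have "[(\<Sum>i<q. z ^ i * (- 1) ^ (q - 1 - i)) = int q] (mod int q)"
    by simp
  then have "int q dvd (\<Sum>i<q. z ^ i * (- 1) ^ (q - 1 - i))"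
    using cong_dvd_iff dvd_refl by blast
  then have "int (q ^ Suc j) * int q dvd z ^ q + 1"
    unfolding e using Suc by (intro mult_dvd_mono) (simp_all add: z_def)
  moreover have "z ^ q = y ^ (q ^ Suc j)"
    unfolding z_def power_mult[symmetric] by (simp add: mult.commute)
  ultimately show ?case
    by (simp add: mult_ac)
qed

text \<open>This turns congruences into equalities, typically for \<open>n - f c\<close>, a multiple
  of an order that is at least \<open>n\<close>.\<close>

lemma multiple_between_eq:
  fixes m x :: int
  assumes "m dvd x" "0 < x" "x < 2 * m"
  shows "x = m"
proof -
  obtain k where k: "x = m * k" using assms(1) by blast
  have "m > 0" using assms by linarith
  then have "0 < k" "k < 2" using assms k by (auto simp: zero_less_mult_iff)
  then show ?thesis using k by auto
qed

section \<open>The integral group ring of a finite abelian group\<close>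

locale finite_comm_group = comm_group G for G (structure) +
  assumes fin: "finite (carrier G)"
begin

abbreviation R where "R \<equiv> int_group_ring G"

sublocale R: cring R
  using cring_int_group_ring[OF comm_group_axioms fin] .

text \<open>
  The linear extension of \<open>F\<close> to the group ring, evaluated at \<open>X\<close>.  Elements of the group ring are
  determined by these values, and on them products and powers become substitutions in \<open>F\<close>.
\<close>

definition pairing :: "('a \<Rightarrow> int) \<Rightarrow> ('a \<Rightarrow> int) \<Rightarrow> int" where
  "pairing X F = (\<Sum>g\<in>carrier G. X g * F g)"

lemma pairing_indicator:
  "g \<in> carrier G \<Longrightarrow> pairing X (\<lambda>h. if h = g then 1 else 0) = X g"
  by (simp add: pairing_def fin if_distrib[of "\<lambda>x. _ * x"] cong: if_cong)

lemma group_ring_eqI: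
  assumes "X \<in> carrier R" "Y \<in> carrier R" "\<And>F. pairing X F = pairing Y F"
  shows "X = Y"
proof
  fix g
  show "X g = Y g"
  proof (cases "g \<in> carrier G")
    case True
    then show ?thesis using assms(3) pairing_indicator by metis
  next
    case False
    then show ?thesis using assms(1,2) by (simp add: int_group_ring_def)
  qed
qed

lemma pairing_cong:
  "(\<And>g. g \<in> carrier G \<Longrightarrow> F g = F' g) \<Longrightarrow> pairing X F = pairing X F'"
  unfolding pairing_def by (intro sum.cong) auto

lemma pairing_mult:
  "pairing (X \<otimes>\<^bsub>R\<^esub> Y) F = pairing X (\<lambda>a. pairing Y (\<lambda>b. F (a \<otimes> b)))"
proof -
  have "pairing (X \<otimes>\<^bsub>R\<^esub> Y) F =
      (\<Sum>g\<in>carrier G. \<Sum>a\<in>carrier G. X a * Y (inv a \<otimes> g) * F g)"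
    by (simp add: pairing_def int_group_ring_def sum_distrib_right)
  also have "\<dots> = (\<Sum>a\<in>carrier G. \<Sum>g\<in>carrier G. X a * Y (inv a \<otimes> g) * F g)"
    by (rule sum.swap)
  also have "\<dots> = (\<Sum>a\<in>carrier G. \<Sum>b\<in>carrier G. X a * Y b * F (a \<otimes> b))"
  proof (rule sum.cong[OF refl])
    fix a assume a: "a \<in> carrier G"
    show "(\<Sum>g\<in>carrier G. X a * Y (inv a \<otimes> g) * F g) = (\<Sum>b\<in>carrier G. X a * Y b * F (a \<otimes> b))"
      by (rule sum.reindex_bij_witness[of _ "\<lambda>b. a \<otimes> b" "\<lambda>g. inv a \<otimes> g"])
         (use a in \<open>auto simp flip: m_assoc\<close>)
  qed
  finally show ?thesis
    by (simp add: pairing_def sum_distrib_left mult.assoc)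
qed

lemma pairing_gr_power: "pairing (gr_power G s X) F = pairing X (\<lambda>h. F (h [^] s))"
proof -
  have "pairing (gr_power G s X) F =
      (\<Sum>g\<in>carrier G. \<Sum>h | h \<in> carrier G \<and> h [^] s = g. X h * F (h [^] s))"
    by (auto simp: pairing_def gr_power_def sum_distrib_right intro!: sum.cong)
  also have "\<dots> = (\<Sum>h\<in>carrier G. X h * F (h [^] s))"
    using sum.group[OF fin fin, of "\<lambda>h. h [^] s" "\<lambda>h. X h * F (h [^] s)"] by auto
  finally show ?thesis by (simp add: pairing_def)
qed

lemma pairing_of_int: "pairing (gr_of_int G c) F = c * F \<one>"
  by (simp add: pairing_def gr_of_int_def fin if_distrib[of "\<lambda>x. x * _"] cong: if_cong)

lemma pairing_one: "pairing \<one>\<^bsub>R\<^esub> F = F \<one>"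
  using pairing_of_int[of 1] by (simp add: gr_of_int_def int_group_ring_def)

lemma gr_sum_pairing: "gr_sum G X = pairing X (\<lambda>_. 1)"
  by (simp add: gr_sum_def pairing_def)

lemma pairing_mult_right: "pairing X (\<lambda>h. F h * c) = pairing X F * c"
  by (simp add: pairing_def sum_distrib_right mult.assoc)

lemma pairing_mult_left: "pairing X (\<lambda>h. c * F h) = c * pairing X F"
  by (simp add: pairing_def sum_distrib_left mult_ac)

lemma gr_power_closed [simp, intro]: "gr_power G s X \<in> carrier R"
proof -
  have "gr_power G s X g = 0" if "g \<notin> carrier G" for g
    unfolding gr_power_def using that by (intro sum.neutral) auto
  then show ?thesis by (simp add: int_group_ring_def)
qed

lemma gr_of_int_closed [simp, intro]: "gr_of_int G c \<in> carrier R"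
  by (auto simp: int_group_ring_def gr_of_int_def)

lemma gr_power_mult:
  "gr_power G s (X \<otimes>\<^bsub>R\<^esub> Y) = gr_power G s X \<otimes>\<^bsub>R\<^esub> gr_power G s Y"
proof (rule group_ring_eqI)
  show "gr_power G s X \<otimes>\<^bsub>R\<^esub> gr_power G s Y \<in> carrier R" by simp
  show "pairing (gr_power G s (X \<otimes>\<^bsub>R\<^esub> Y)) F = pairing (gr_power G s X \<otimes>\<^bsub>R\<^esub> gr_power G s Y) F" for F
    by (simp add: pairing_mult pairing_gr_power) (intro pairing_cong, simp add: int_pow_distrib)
qed simp

lemma gr_power_gr_power: "gr_power G r (gr_power G s X) = gr_power G (s * r) X"
  by (rule group_ring_eqI) (auto simp: pairing_gr_power int_pow_pow intro!: pairing_cong)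

lemma gr_power_of_int: "gr_power G s (gr_of_int G c) = gr_of_int G c"
  by (rule group_ring_eqI) (auto simp: pairing_gr_power pairing_of_int)

lemma gr_power_one: "X \<in> carrier R \<Longrightarrow> gr_power G 1 X = X"
  by (rule group_ring_eqI) (auto simp: pairing_gr_power intro!: pairing_cong)

lemma gr_power_cong:
  assumes "int (order G) dvd s - r"
  shows "gr_power G s X = gr_power G r X"
proof (rule group_ring_eqI)
  have "g [^] s = g [^] r" if "g \<in> carrier G" for g
    using that assms ord_dvd_group_order[OF that]
    by (simp add: int_pow_eq dvd_diff_commute) (meson dvd_trans int_dvd_int_iff)
  then show "pairing (gr_power G s X) F = pairing (gr_power G r X) F" for F
    by (auto simp: pairing_gr_power intro!: pairing_cong)
qed auto

lemma gr_power_zero: "gr_power G 0 X = gr_of_int G (gr_sum G X)"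
  by (rule group_ring_eqI)
     (auto simp: pairing_gr_power pairing_of_int gr_sum_pairing simp flip: pairing_mult_right)

lemma gr_sum_gr_power: "gr_sum G (gr_power G s X) = gr_sum G X"
  by (simp add: gr_sum_pairing pairing_gr_power)

lemma gr_power_iterate:
  assumes "X \<in> carrier R" "gr_power G t X = X"
  shows "gr_power G (t ^ k) X = X"
proof (induction k)
  case 0
  then show ?case using assms by (simp add: gr_power_one)
next
  case (Suc k)
  have "gr_power G (t ^ Suc k) X = gr_power G (t ^ k) (gr_power G t X)"
    by (simp only: gr_power_gr_power power_Suc)
  then show ?case using Suc assms(2) by (simp only:)
qed

section \<open>Orbits of the map g -> g^t\<close>

lemma int_pow_inj_on:
  assumes "coprime t (int (order G))"
  shows "inj_on (\<lambda>g. g [^] t) (carrier G)"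
proof (rule inj_onI)
  fix g h assume g: "g \<in> carrier G" and h: "h \<in> carrier G" and e: "g [^] t = h [^] t"
  obtain r where "[t * r = 1] (mod int (order G))"
    using cong_solve_coprime_int[OF assms] by blast
  then have "int (order G) dvd t * r - 1"
    by (simp add: cong_iff_dvd_diff)
  then have "x [^] (t * r) = x [^] (1::int)" if "x \<in> carrier G" for x
    using that ord_dvd_group_order[OF that] int_pow_eq[OF that, of 1 "t * r"]
    by (metis dvd_trans int_dvd_int_iff)
  then show "g = h"
    using g h e by (metis int_pow_1 int_pow_pow)
qed

lemma gr_power_invariant_apply:
  assumes "coprime t (int (order G))" "gr_power G t X = X" and g: "g \<in> carrier G"
  shows "X (g [^] t) = X g"
proof -
  have "{h. h \<in> carrier G \<and> h [^] t = g [^] t} = {g}"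
    using inj_onD[OF int_pow_inj_on[OF assms(1)]] g by auto
  then have "gr_power G t X (g [^] t) = X g"
    by (simp add: gr_power_def)
  then show ?thesis using assms(2) by simp
qed

text \<open>\<open>A\<close> is a union of orbits of g -> g^t. By invariance \<open>X\<close> is
  constant on each, and the orbit of \<open>g\<close> has as many elements as the order of
  \<open>t\<close> modulo \<open>ord g\<close>, a multiple of \<open>m\<close>. The induction
  removes one orbit at a time.\<close>

lemma dvd_sum_power_stable:
  assumes t: "coprime t (int (order G))" and X: "gr_power G t X = X"
    and A: "A \<subseteq> carrier G" "\<And>g. g \<in> A \<Longrightarrow> g [^] t \<in> A"
    and m: "\<And>g. g \<in> A \<Longrightarrow> m dvd Pocklington.ord (int (ord g)) t"
  shows "int m dvd sum X A"
proof -
  have "finite A" using A(1) fin by (rule finite_subset)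
  then show ?thesis using A m
  proof (induction A rule: finite_psubset_induct)
    case (psubset A)
    show ?case
    proof (cases "A = {}")
      case False
      then obtain g where g: "g \<in> A" by blast
      then have gG: "g \<in> carrier G" using psubset.prems(1) by blast
      define k where "k = Pocklington.ord (int (ord g)) t"
      define orb where "orb = (\<lambda>i. g [^] (t ^ i))"
      have og: "ord g > 0" using ord_ge_1[OF fin gG] by simp
      have ct: "coprime (int (ord g)) t"
        using t ord_dvd_group_order[OF gG]
        by (meson coprime_commute coprime_divisors dvd_refl int_dvd_int_iff)
      have orb_eq_le: "orb i = orb j \<longleftrightarrow> k dvd j - i" if "i \<le> j" for i j
      proof -
        have "orb i = orb j \<longleftrightarrow> int (ord g) dvd t ^ j - t ^ i"
          using gG by (simp add: orb_def int_pow_eq)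
        also have "t ^ j - t ^ i = t ^ i * (t ^ (j - i) - 1)"
          using that by (simp add: algebra_simps flip: power_add)
        also have "int (ord g) dvd \<dots> \<longleftrightarrow> int (ord g) dvd t ^ (j - i) - 1"
          using ct by (simp add: coprime_dvd_mult_right_iff)
        also have "\<dots> \<longleftrightarrow> k dvd j - i"
          unfolding k_def using og by (simp add: ord_int_divides[symmetric] cong_iff_dvd_diff)
        finally show ?thesis .
      qed
      have k0: "k > 0"
        using og ct by (simp add: k_def ord_int_pos)
      have orb_Suc: "orb (Suc i) = orb i [^] t" for i
        using gG by (simp add: orb_def int_pow_pow mult.commute)
      have orbA: "orb i \<in> A" for i
      proof (induction i)
        case 0
        then show ?case using g gG by (simp add: orb_def)
      next
        case (Suc i)
        then show ?case by (simp add: orb_Suc psubset.prems(2))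
      qed
      have inj: "inj_on orb {..<k}"
      proof (rule inj_onI)
        fix i j assume ij: "i \<in> {..<k}" "j \<in> {..<k}" "orb i = orb j"
        show "i = j"
        proof (cases "i \<le> j")
          case True
          then have "k dvd j - i" using orb_eq_le ij by simp
          then show ?thesis using ij True by (auto dest: dvd_imp_le)
        next
          case False
          then have "k dvd i - j" using orb_eq_le[of j i] ij by simp
          then show ?thesis using ij False by (auto dest: dvd_imp_le)
        qed
      qed
      have rng: "orb i \<in> orb ` {..<k}" for i
      proof -
        have "orb (i mod k) = orb i"
          using orb_eq_le[of "i mod k" i] by (simp add: minus_mod_eq_mult_div)
        then show ?thesis
          using k0 by (metis imageI lessThan_iff mod_less_divisor)
      qed
      define Q where "Q = orb ` {..<k}"
      have Xorb: "X (orb i) = X g" for i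
      proof (induction i)
        case 0
        then show ?case using gG by (simp add: orb_def)
      next
        case (Suc i)
        have "orb i \<in> carrier G" using orbA psubset.prems(1) by blast
        then show ?case
          using Suc gr_power_invariant_apply[OF t X] by (simp add: orb_Suc)
      qed
      have "sum X Q = int k * X g"
        unfolding Q_def by (simp add: sum.reindex[OF inj] Xorb)
      then have dQ: "int m dvd sum X Q"
        using psubset.prems(3)[OF g] by (simp add: k_def)
      have QA: "Q \<subseteq> A" using orbA by (auto simp: Q_def)
      have "g \<in> Q" using rng[of 0] gG by (simp add: orb_def Q_def)
      then have "A - Q \<subset> A" using g by blast
      moreover have "h [^] t \<in> A - Q" if h: "h \<in> A - Q" for h
      proof -
        have "h [^] t \<notin> Q"
        proof
          assume "h [^] t \<in> Q"
          then obtain i where i: "h [^] t = orb i" by (auto simp: Q_def)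
          \<comment> \<open>Going once more round the orbit gives \<open>orb i\<close> a predecessor
            even when \<open>i = 0\<close>, so injectivity puts \<open>h\<close> itself into the
            orbit.\<close>
          have "orb i = orb (i + k)" using orb_eq_le[of i "i + k"] by simp
          also have "i + k = Suc (i + k - 1)" using k0 by simp
          finally have "h [^] t = orb (i + k - 1) [^] t" using i orb_Suc by metis
          then have "h = orb (i + k - 1)"
            using inj_onD[OF int_pow_inj_on[OF t]] h orbA psubset.prems(1) by blast
          then show False using h rng by (auto simp: Q_def)
        qed
        then show ?thesis using h psubset.prems(2) by blast
      qed
      ultimately have "int m dvd sum X (A - Q)"
        using psubset.prems by (intro psubset.IH) auto
      moreover have "sum X A = sum X (A - Q) + sum X Q"
        using QA psubset.hyps by (simp add: sum.subset_diff)
      ultimately show ?thesis using dQ by simp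
    qed simp
  qed
qed

lemma gr_power_at_one: "gr_power G (int d) X \<one> = sum X {g \<in> carrier G. g [^] d = \<one>}"
  by (simp add: gr_power_def int_pow_int)

text \<open>The difference is the sum of \<open>X\<close> over the elements killed by
  \<open>d\<close> but not by \<open>c\<close>, a set stable under g -> g^t. The divisor
  \<open>q\<close> of \<open>ord g\<close> may vary with \<open>g\<close>.\<close>

lemma dvd_gr_power_diff:
  assumes t: "coprime t (int (order G))" and X: "gr_power G t X = X" and cd: "c dvd d"
    and m: "\<And>g. g \<in> carrier G \<Longrightarrow> g [^] d = \<one> \<Longrightarrow> g [^] c \<noteq> \<one> \<Longrightarrow>
              \<exists>q>0. q dvd ord g \<and> m dvd Pocklington.ord (int q) t"
  shows "int m dvd gr_power G (int d) X \<one> - gr_power G (int c) X \<one>"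
proof -
  let ?T = "\<lambda>d. {g \<in> carrier G. g [^] d = \<one>}"
  have sub: "?T c \<subseteq> ?T d"
    using cd by (auto simp: pow_eq_id intro: dvd_trans)
  have "int m dvd sum X (?T d - ?T c)"
  proof (rule dvd_sum_power_stable[OF t X])
    fix g assume g: "g \<in> ?T d - ?T c"
    have comm: "(g [^] t) [^] e = (g [^] e) [^] t" for e :: nat
      using g by (simp add: int_pow_pow mult.commute flip: int_pow_int)
    have "(g [^] c) [^] t \<noteq> \<one>"
      using g inj_onD[OF int_pow_inj_on[OF t], of "g [^] c" \<one>] by auto
    then show "g [^] t \<in> ?T d - ?T c"
      using g by (simp add: comm)
    obtain q where q: "q > 0" "q dvd ord g" "m dvd Pocklington.ord (int q) t"
      using m g by auto
    have og: "ord g > 0" using ord_ge_1[OF fin] g by fastforce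
    have "[t ^ Pocklington.ord (int (ord g)) t = 1] (mod int (ord g))"
      using og by (simp add: ord_int_divides)
    then have "[t ^ Pocklington.ord (int (ord g)) t = 1] (mod int q)"
      using q(2) by (meson cong_dvd_modulus int_dvd_int_iff)
    then show "m dvd Pocklington.ord (int (ord g)) t"
      using q by (simp add: ord_int_divides) (meson dvd_trans)
  qed auto
  moreover have "sum X (?T d) = sum X (?T d - ?T c) + sum X (?T c)"
    using sub fin by (intro sum.subset_diff) auto
  ultimately show ?thesis by (simp add: gr_power_at_one)
qed

section \<open>The coefficient of the identity when Y Y^(-1) = n^2\<close>

lemma pairing_self:
  "pairing Y Y = (Y \<otimes>\<^bsub>R\<^esub> gr_power G (-1) Y) \<one>"
proof -
  let ?F = "\<lambda>h. if h = \<one> then 1 else 0 :: int"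
  have "(Y \<otimes>\<^bsub>R\<^esub> gr_power G (-1) Y) \<one> =
      pairing Y (\<lambda>a. pairing Y (\<lambda>b. ?F (a \<otimes> b [^] (-1::int))))"
    by (simp add: pairing_mult pairing_gr_power flip: pairing_indicator[OF one_closed])
  \<comment> \<open>Only the pairs with \<open>a = b\<close> reach the identity, which leaves the
    sum of the squares of the coefficients.\<close>
  also have "\<dots> = pairing Y (\<lambda>a. pairing Y (\<lambda>b. if b = a then 1 else 0))"
  proof (intro pairing_cong)
    fix a b assume "a \<in> carrier G" "b \<in> carrier G"
    then have "a \<otimes> b [^] (-1::int) = \<one> \<longleftrightarrow> b = a"
      using inv_solve_right'[of \<one> a b] by (auto simp: int_pow_neg)
    then show "?F (a \<otimes> b [^] (-1::int)) = (if b = a then 1 else 0)" by simp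
  qed
  also have "\<dots> = pairing Y Y"
    by (intro pairing_cong) (simp add: pairing_indicator)
  finally show ?thesis ..
qed

text \<open>The squares of the coefficients add up to n^2, which bounds the one at the identity. If
  that one exhausts the sum, the others vanish, and the coefficient sum \<open>n\<close> rules out
  the value \<open>- n\<close>.\<close>

lemma unitary_coeff_one:
  assumes Y: "Y \<in> carrier R" "Y \<otimes>\<^bsub>R\<^esub> gr_power G (-1) Y = gr_of_int G (n\<^sup>2)"
    and n: "gr_sum G Y = n" "n \<ge> 1"
  shows "- n < Y \<one>" "Y \<one> \<le> n" "Y \<one> = n \<Longrightarrow> Y = gr_of_int G n"
proof -
  have "pairing Y Y = n\<^sup>2"
    by (simp add: pairing_self Y(2) gr_of_int_def)
  then have sq: "(Y \<one>)\<^sup>2 + (\<Sum>g\<in>carrier G - {\<one>}. (Y g)\<^sup>2) = n\<^sup>2"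
    by (simp add: pairing_def power2_eq_square sum.remove[OF fin one_closed])
  moreover have nonneg: "(\<Sum>g\<in>carrier G - {\<one>}. (Y g)\<^sup>2) \<ge> 0"
    by (intro sum_nonneg) simp
  ultimately have "(Y \<one>)\<^sup>2 \<le> n\<^sup>2" by linarith
  then have ab: "\<bar>Y \<one>\<bar> \<le> n"
    using n(2) by (simp add: abs_le_square_iff[symmetric])
  have eq: "Y = gr_of_int G (Y \<one>) \<and> Y \<one> = n" if "(Y \<one>)\<^sup>2 = n\<^sup>2"
  proof -
    have "(\<Sum>g\<in>carrier G - {\<one>}. (Y g)\<^sup>2) = 0" using sq that by simp
    then have "\<forall>g\<in>carrier G - {\<one>}. (Y g)\<^sup>2 = 0"
      using fin by (subst (asm) sum_nonneg_eq_0_iff) auto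
    then have "Y g = 0" if "g \<noteq> \<one>" for g
      using Y(1) that by (cases "g \<in> carrier G") (auto simp: int_group_ring_def)
    then have e: "Y = gr_of_int G (Y \<one>)" by (auto simp: gr_of_int_def)
    have "gr_sum G Y = Y \<one>"
      by (subst e) (simp add: gr_sum_pairing pairing_of_int)
    then show ?thesis using e n by simp
  qed
  show "Y \<one> \<le> n" using ab by simp
  show "Y = gr_of_int G n" if "Y \<one> = n" using eq that by simp
  have "Y \<one> \<noteq> - n" using eq n(2) by auto
  then show "- n < Y \<one>" using ab by linarith
qed

end

section \<open>The Frobenius congruence and square roots of \<open>n\<^sup>2\<close>\<close>

text \<open>Pascal's rule, shaped for the inductive step of \<open>pairing_binomial\<close>:
  \<open>P i j\<close> stands for the term of X^i Y^j.\<close>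

lemma sum_binomial_Suc:
  fixes P :: "nat \<Rightarrow> nat \<Rightarrow> int"
  shows "(\<Sum>i\<le>Suc k. int (Suc k choose i) * P i (Suc k - i)) =
         (\<Sum>i\<le>k. int (k choose i) * (P (Suc i) (k - i) + P i (Suc k - i)))"
proof -
  have "(\<Sum>i\<le>k. int (k choose i) * P i (Suc k - i)) =
      (\<Sum>i\<le>Suc k. int (k choose i) * P i (Suc k - i))"
    by simp
  also have "\<dots> = P 0 (Suc k) + (\<Sum>i\<le>k. int (k choose Suc i) * P (Suc i) (k - i))"
    by (subst sum.atMost_Suc_shift) simp
  finally show ?thesis
    by (subst sum.atMost_Suc_shift) (simp add: algebra_simps sum.distrib)
qed

context finite_comm_group
begin

lemma pairing_add: "pairing (X \<oplus>\<^bsub>R\<^esub> Y) F = pairing X F + pairing Y F"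
  by (simp add: pairing_def int_group_ring_def distrib_right sum.distrib)

lemma pairing_add_right: "pairing X (\<lambda>h. F h + F' h) = pairing X F + pairing X F'"
  by (simp add: pairing_def distrib_left sum.distrib)

text \<open>The test function \<open>F\<close> is generalised in the induction because splitting off
  a factor of the power replaces \<open>F\<close> by a combination of its translates.\<close>

lemma pairing_binomial:
  assumes X: "X \<in> carrier R" and Y: "Y \<in> carrier R"
  shows "pairing ((X \<oplus>\<^bsub>R\<^esub> Y) [^]\<^bsub>R\<^esub> k) F =
         (\<Sum>i\<le>k. int (k choose i) * pairing (X [^]\<^bsub>R\<^esub> i \<otimes>\<^bsub>R\<^esub> Y [^]\<^bsub>R\<^esub> (k - i)) F)"
proof (induction k arbitrary: F)
  case 0
  then show ?case by simp
next
  case (Suc k)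
  let ?P = "\<lambda>i j. pairing (X [^]\<^bsub>R\<^esub> i \<otimes>\<^bsub>R\<^esub> Y [^]\<^bsub>R\<^esub> j) F"
  have step: "pairing (X [^]\<^bsub>R\<^esub> i \<otimes>\<^bsub>R\<^esub> Y [^]\<^bsub>R\<^esub> (k - i))
        (\<lambda>a. pairing (X \<oplus>\<^bsub>R\<^esub> Y) (\<lambda>b. F (a \<otimes> b))) =
      ?P (Suc i) (k - i) + ?P i (Suc k - i)" if "i \<le> k" for i
  proof -
    let ?M = "X [^]\<^bsub>R\<^esub> i \<otimes>\<^bsub>R\<^esub> Y [^]\<^bsub>R\<^esub> (k - i)"
    have "pairing ?M (\<lambda>a. pairing (X \<oplus>\<^bsub>R\<^esub> Y) (\<lambda>b. F (a \<otimes> b))) =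
        pairing (?M \<otimes>\<^bsub>R\<^esub> X) F + pairing (?M \<otimes>\<^bsub>R\<^esub> Y) F"
      unfolding pairing_add pairing_add_right pairing_mult ..
    also have "?M \<otimes>\<^bsub>R\<^esub> X = X [^]\<^bsub>R\<^esub> Suc i \<otimes>\<^bsub>R\<^esub> Y [^]\<^bsub>R\<^esub> (k - i)"
      using X Y by (simp add: R.m_ac)
    also have "?M \<otimes>\<^bsub>R\<^esub> Y = X [^]\<^bsub>R\<^esub> i \<otimes>\<^bsub>R\<^esub> Y [^]\<^bsub>R\<^esub> (Suc k - i)"
      using X Y that by (simp add: R.m_assoc Suc_diff_le)
    finally show ?thesis .
  qed
  have "pairing ((X \<oplus>\<^bsub>R\<^esub> Y) [^]\<^bsub>R\<^esub> Suc k) F =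
      (\<Sum>i\<le>k. int (k choose i) * (?P (Suc i) (k - i) + ?P i (Suc k - i)))"
    unfolding R.nat_pow_Suc pairing_mult[of "(X \<oplus>\<^bsub>R\<^esub> Y) [^]\<^bsub>R\<^esub> k"] Suc.IH
    by (intro sum.cong refl) (simp add: step)
  then show ?case
    using sum_binomial_Suc[of k ?P] by simp
qed

lemma freshmans_dream:
  assumes q: "prime q" and X: "X \<in> carrier R" and Y: "Y \<in> carrier R"
  shows "int q dvd pairing ((X \<oplus>\<^bsub>R\<^esub> Y) [^]\<^bsub>R\<^esub> q) F
           - (pairing (X [^]\<^bsub>R\<^esub> q) F + pairing (Y [^]\<^bsub>R\<^esub> q) F)"
proof -
  let ?P = "\<lambda>i. int (q choose i) * pairing (X [^]\<^bsub>R\<^esub> i \<otimes>\<^bsub>R\<^esub> Y [^]\<^bsub>R\<^esub> (q - i)) F"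
  have q0: "q > 0" using q by (rule prime_gt_0_nat)
  have "{..q} = insert 0 (insert q {0<..<q})" using q0 by auto
  then have "(\<Sum>i\<le>q. ?P i) = ?P 0 + ?P q + (\<Sum>i\<in>{0<..<q}. ?P i)"
    using q0 by simp
  then have "pairing ((X \<oplus>\<^bsub>R\<^esub> Y) [^]\<^bsub>R\<^esub> q) F
      - (pairing (X [^]\<^bsub>R\<^esub> q) F + pairing (Y [^]\<^bsub>R\<^esub> q) F) = (\<Sum>i\<in>{0<..<q}. ?P i)"
    using X Y by (simp add: pairing_binomial)
  moreover have "int q dvd (\<Sum>i\<in>{0<..<q}. ?P i)"
  proof (intro dvd_sum dvd_mult2)
    fix i assume "i \<in> {0<..<q}"
    then show "int q dvd int (q choose i)"
      using dvd_choose_prime[of i q] q by auto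
  qed
  ultimately show ?thesis by simp
qed

text \<open>Elements are built up one monomial at a time: \<open>freshmans_dream\<close> splits off
  the new monomial, for which the claim is Fermat's congruence for its coefficient.\<close>

lemma frobenius_congruence:
  assumes q: "prime q" and X: "X \<in> carrier R"
  shows "int q dvd pairing (X [^]\<^bsub>R\<^esub> q) F - pairing (gr_power G (int q) X) F"
proof -
  define mono where "mono = (\<lambda>c (h::'a) g. if g = h then c else 0 :: int)"
  have mono_closed: "mono c h \<in> carrier R" if "h \<in> carrier G" for c h
    using that by (auto simp: mono_def int_group_ring_def)
  have pairing_mono: "pairing (mono c h) F = c * F h" if "h \<in> carrier G" for c h F
    using that
    by (simp add: mono_def pairing_def fin if_distrib[of "\<lambda>x. x * _"] cong: if_cong)
  have mono_pow: "pairing (mono c h [^]\<^bsub>R\<^esub> k) F = c ^ k * F (h [^] k)"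
    if h: "h \<in> carrier G" for c h F and k :: nat
  proof (induction k arbitrary: F)
    case 0
    then show ?case by (simp add: pairing_one)
  next
    case (Suc k)
    then show ?case using h by (simp add: pairing_mult pairing_mono)
  qed
  have "\<forall>X. (\<forall>g. g \<notin> B \<longrightarrow> X g = 0) \<longrightarrow>
      int q dvd pairing (X [^]\<^bsub>R\<^esub> q) F - pairing (gr_power G (int q) X) F"
    if "finite B" "B \<subseteq> carrier G" for B
    using that
  proof (induction B rule: finite_induct)
    case empty
    show ?case
    proof (intro allI impI)
      fix X :: "'a \<Rightarrow> int" assume "\<forall>g. g \<notin> {} \<longrightarrow> X g = 0"
      then have e: "X = \<zero>\<^bsub>R\<^esub>" by (auto simp: int_group_ring_def)
      have "pairing \<zero>\<^bsub>R\<^esub> F = 0" for F by (simp add: pairing_def int_group_ring_def)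
      moreover have "\<zero>\<^bsub>R\<^esub> [^]\<^bsub>R\<^esub> q = \<zero>\<^bsub>R\<^esub>"
        using q prime_gt_0_nat[of q] by (simp add: R.nat_pow_zero)
      ultimately show "int q dvd pairing (X [^]\<^bsub>R\<^esub> q) F - pairing (gr_power G (int q) X) F"
        by (simp add: e pairing_gr_power)
    qed
  next
    case (insert h B)
    show ?case
    proof (intro allI impI)
      fix X :: "'a \<Rightarrow> int" assume X: "\<forall>g. g \<notin> insert h B \<longrightarrow> X g = 0"
      define Y where "Y = X(h := 0)"
      have h: "h \<in> carrier G" using insert.prems by simp
      have Y: "\<forall>g. g \<notin> B \<longrightarrow> Y g = 0" using X by (simp add: Y_def)
      then have YR: "Y \<in> carrier R" using insert.prems by (auto simp: int_group_ring_def)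
      have e: "X = Y \<oplus>\<^bsub>R\<^esub> mono (X h) h"
        by (auto simp: int_group_ring_def Y_def mono_def)
      have 1: "int q dvd pairing (X [^]\<^bsub>R\<^esub> q) F
           - (pairing (Y [^]\<^bsub>R\<^esub> q) F + pairing (mono (X h) h [^]\<^bsub>R\<^esub> q) F)"
        using freshmans_dream[OF q YR mono_closed[OF h, of "X h"], of F] e by simp
      have 2: "int q dvd pairing (Y [^]\<^bsub>R\<^esub> q) F - pairing (gr_power G (int q) Y) F"
        using insert.IH insert.prems Y by simp
      have "pairing (mono (X h) h [^]\<^bsub>R\<^esub> q) F - pairing (gr_power G (int q) (mono (X h) h)) F
          = (X h ^ q - X h) * F (h [^] q)"
        using h by (simp add: mono_pow pairing_gr_power pairing_mono int_pow_int algebra_simps)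
      then have 3: "int q dvd pairing (mono (X h) h [^]\<^bsub>R\<^esub> q) F
          - pairing (gr_power G (int q) (mono (X h) h)) F"
        using fermat_int[OF q] by simp
      have 4: "pairing (gr_power G (int q) X) F =
          pairing (gr_power G (int q) Y) F + pairing (gr_power G (int q) (mono (X h) h)) F"
        by (subst e) (simp add: pairing_gr_power pairing_add)
      show "int q dvd pairing (X [^]\<^bsub>R\<^esub> q) F - pairing (gr_power G (int q) X) F"
        using dvd_add[OF dvd_add[OF 1 2] 3] by (simp add: 4 algebra_simps)
    qed
  qed
  then show ?thesis
    using X fin by (auto simp: int_group_ring_def)
qed

lemma dvd_mult_apply:
  assumes "\<And>g. r dvd U g" "\<And>g. s dvd V g"
  shows "r * s dvd (U \<otimes>\<^bsub>R\<^esub> V) g"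
  using assms by (auto simp: int_group_ring_def intro!: dvd_sum mult_dvd_mono)

text \<open>
  By Frobenius, \<open>D = Y - Y\<^sup>(\<^sup>q\<^sup>)\<close> vanishes modulo \<open>q\<close>.  As \<open>Y\<close> and \<open>Y\<^sup>(\<^sup>q\<^sup>)\<close> have the same square,
  \<open>Y D\<^sup>2 = 2 n\<^sup>2 D\<close>, so divisibility of \<open>D\<close> by \<open>q\<^sup>k\<close> bootstraps to divisibility by \<open>q\<^sup>2\<^sup>k\<close>.
\<close>

lemma square_root_gr_power_prime:
  assumes Y: "Y \<in> carrier R" "Y \<otimes>\<^bsub>R\<^esub> Y = gr_of_int G (n\<^sup>2)"
    and q: "prime q" "coprime (2 * n) (int q)"
  shows "gr_power G (int q) Y = Y"
proof -
  define B where "B = gr_power G (int q) Y"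
  have BR: "B \<in> carrier R" by (simp add: B_def)
  have BB: "B \<otimes>\<^bsub>R\<^esub> B = gr_of_int G (n\<^sup>2)"
    by (simp add: B_def Y(2) gr_power_of_int flip: gr_power_mult)
  have scalar: "pairing (Z \<otimes>\<^bsub>R\<^esub> gr_of_int G c) F = c * pairing Z F" for Z c F
    by (simp add: pairing_mult pairing_of_int pairing_mult_left cong: pairing_cong)
  \<comment> \<open>As \<open>Y\<close> squares to a scalar, its odd powers are multiples of
    \<open>Y\<close>; for exponent \<open>q\<close> the factor will be 1 modulo \<open>q\<close> by
    Fermat.\<close>
  have odd_pow: "pairing (Y [^]\<^bsub>R\<^esub> Suc (2 * k)) F = n ^ (2 * k) * pairing Y F" for k F
  proof (induction k)
    case 0
    then show ?case using Y by simp
  next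
    case (Suc k)
    have "Y [^]\<^bsub>R\<^esub> Suc (2 * Suc k) = Y [^]\<^bsub>R\<^esub> Suc (2 * k) \<otimes>\<^bsub>R\<^esub> gr_of_int G (n\<^sup>2)"
      using Y(1) by (simp add: R.m_assoc flip: Y(2))
    then show ?case
      using Suc by (simp only: scalar) (simp add: power2_eq_square)
  qed
  have "odd q" and qn: "coprime n (int q)"
    using q(2) by auto
  then obtain k where k: "q = Suc (2 * k)" by (metis oddE Suc_eq_plus1)
  have "int q dvd n * (n ^ (2 * k) - 1)"
    using fermat_int[OF q(1), of n] k by (simp add: algebra_simps)
  then have n1: "int q dvd n ^ (2 * k) - 1"
    using qn by (simp add: coprime_dvd_mult_right_iff coprime_commute)
  define D where "D = (\<lambda>g. Y g - B g)"
  have DR: "D \<in> carrier R"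
    using Y(1) BR by (simp add: D_def int_group_ring_def)
  have D_pair: "pairing D F = pairing Y F - pairing B F" for F
    by (simp add: D_def pairing_def left_diff_distrib sum_subtractf)
  have D0: "D g = 0" if "g \<notin> carrier G" for g
    using DR that by (simp add: int_group_ring_def)
  have base: "int q dvd D g" for g
  proof (cases "g \<in> carrier G")
    case True
    let ?F = "\<lambda>h. if h = g then 1 else 0 :: int"
    have "int q dvd n ^ (2 * k) * Y g - B g"
      using frobenius_congruence[OF q(1) Y(1), of ?F] odd_pow[of k ?F] True
      by (simp only: k[symmetric] B_def[symmetric] pairing_indicator)
    moreover have "D g = (n ^ (2 * k) * Y g - B g) - (n ^ (2 * k) - 1) * Y g"
      by (simp add: D_def algebra_simps)
    ultimately show ?thesis using n1 by (metis dvd_diff dvd_mult2)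
  qed (simp add: D0)
  \<comment> \<open>Here Y^3 and Y B^2 both equal n^2 Y, while each mixed product equals n^2
    B.\<close>
  have bilin: "pairing (Y \<otimes>\<^bsub>R\<^esub> (D \<otimes>\<^bsub>R\<^esub> D)) F = 2 * n\<^sup>2 * pairing D F" for F
  proof -
    have diff: "pairing X (\<lambda>h. F h - F' h) = pairing X F - pairing X F'" for X F F'
      by (simp add: pairing_def right_diff_distrib sum_subtractf)
    have "pairing (Y \<otimes>\<^bsub>R\<^esub> (D \<otimes>\<^bsub>R\<^esub> D)) F =
        pairing (Y \<otimes>\<^bsub>R\<^esub> (Y \<otimes>\<^bsub>R\<^esub> Y)) F - pairing (Y \<otimes>\<^bsub>R\<^esub> (Y \<otimes>\<^bsub>R\<^esub> B)) F
        - (pairing (Y \<otimes>\<^bsub>R\<^esub> (B \<otimes>\<^bsub>R\<^esub> Y)) F - pairing (Y \<otimes>\<^bsub>R\<^esub> (B \<otimes>\<^bsub>R\<^esub> B)) F)"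
      by (simp add: pairing_mult D_pair diff)
    also have "Y \<otimes>\<^bsub>R\<^esub> (Y \<otimes>\<^bsub>R\<^esub> B) = B \<otimes>\<^bsub>R\<^esub> (Y \<otimes>\<^bsub>R\<^esub> Y)"
      using Y(1) BR by (simp add: R.m_ac)
    also have "Y \<otimes>\<^bsub>R\<^esub> (B \<otimes>\<^bsub>R\<^esub> Y) = B \<otimes>\<^bsub>R\<^esub> (Y \<otimes>\<^bsub>R\<^esub> Y)"
      using Y(1) BR by (simp add: R.m_ac)
    finally show ?thesis
      by (simp add: Y(2) BB scalar D_pair algebra_simps)
  qed
  have pow: "int q ^ Suc j dvd D g" for j g
  proof (induction j arbitrary: g)
    case 0
    then show ?case using base by simp
  next
    case (Suc j)
    show ?case
    proof (cases "g \<in> carrier G")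
      case True
      \<comment> \<open>The factor 1 is the trivial divisor of the coefficients of
        \<open>Y\<close>.\<close>
      have "1 * (int q ^ Suc j * int q ^ Suc j) dvd (Y \<otimes>\<^bsub>R\<^esub> (D \<otimes>\<^bsub>R\<^esub> D)) g"
        by (intro dvd_mult_apply Suc) simp
      also have "(Y \<otimes>\<^bsub>R\<^esub> (D \<otimes>\<^bsub>R\<^esub> D)) g = 2 * n\<^sup>2 * D g"
        using bilin[of "\<lambda>h. if h = g then 1 else 0"] True by (simp add: pairing_indicator)
      finally have "int q ^ Suc j * int q ^ Suc j dvd 2 * n\<^sup>2 * D g" by simp
      moreover have "coprime (int q ^ Suc j * int q ^ Suc j) (2 * n\<^sup>2)"
        using q(2) by (auto simp: coprime_commute)
      ultimately have "int q ^ Suc j * int q ^ Suc j dvd D g"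
        by (simp add: coprime_dvd_mult_right_iff)
      moreover have "int q ^ Suc (Suc j) dvd int q ^ Suc j * int q ^ Suc j"
        by (simp add: le_imp_power_dvd flip: power_add)
      ultimately show ?thesis by (rule dvd_trans[rotated])
    qed (simp add: D0)
  qed
  have "D g = 0" for g
  proof (rule ccontr)
    assume D: "D g \<noteq> 0"
    let ?j = "nat \<bar>D g\<bar>"
    have "int q ^ Suc ?j \<le> \<bar>D g\<bar>"
      using dvd_imp_le_int[OF D pow[of ?j g]] by simp
    moreover have "int ?j < int q ^ ?j"
      using prime_gt_1_nat[OF q(1)]
      by (metis One_nat_def of_nat_less_iff of_nat_power power_gt_expt)
    moreover have "int q ^ ?j \<le> int q ^ Suc ?j"
      using prime_gt_1_nat[OF q(1)] by (intro power_increasing) auto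
    ultimately show False by simp
  qed
  then have "Y = B" by (auto simp: D_def)
  then show ?thesis by (simp add: B_def)
qed

text \<open>Exponents compose, so invariance under primes extends to all divisors of the group
  order; the order itself acts like the exponent 0, which collapses \<open>Y\<close> to its
  coefficient sum.\<close>

lemma square_root_eq_of_int:
  assumes Y: "Y \<in> carrier R" "Y \<otimes>\<^bsub>R\<^esub> Y = gr_of_int G (n\<^sup>2)" "gr_sum G Y = n"
    and c: "coprime (2 * n) (int (order G))"
  shows "Y = gr_of_int G n"
proof -
  have N0: "order G > 0" using fin order_gt_0_iff_finite by blast
  have "d dvd order G \<Longrightarrow> gr_power G (int d) Y = Y" for d
  proof (induction d rule: less_induct)
    case (less d)
    have d0: "d > 0" using less.prems N0 by (auto intro: Nat.gr0I)
    show ?case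
    proof (cases "d = 1")
      case True
      then show ?thesis using Y(1) by (simp add: gr_power_one)
    next
      case False
      then obtain q where q: "prime q" "q dvd d" using prime_factor_nat by blast
      then obtain e where e: "d = e * q" by (metis dvdE mult.commute)
      have "e < d" "e dvd order G"
        using e d0 prime_gt_1_nat[OF q(1)] less.prems by (auto intro: dvd_trans)
      then have "gr_power G (int e) Y = Y" using less.IH by blast
      moreover have "coprime (2 * n) (int q)"
        using c q(2) less.prems by (meson coprime_divisors dvd_refl dvd_trans int_dvd_int_iff)
      then have "gr_power G (int q) Y = Y"
        using square_root_gr_power_prime Y q by blast
      ultimately show ?thesis
        using gr_power_gr_power[of "int q" "int e" Y] by (simp add: e)
    qed
  qed
  then have "Y = gr_power G (int (order G)) Y" by simp
  also have "\<dots> = gr_power G 0 Y" by (rule gr_power_cong) simp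
  finally show ?thesis using Y(3) by (simp add: gr_power_zero)
qed

end

section \<open>The least divisor of \<open>d0\<close> at which \<open>f\<close> takes the value
  \<open>n\<close>\<close>

theorem theorem14:
  fixes G :: "('a, 'b) monoid_scheme" and t n :: int and X :: "'a \<Rightarrow> int"
  assumes "comm_group G" and "finite (carrier G)"
    and "coprime t (int (order G))"
    and "X \<in> carrier (int_group_ring G)"
    and "gr_power G t X = X"
    and "n \<ge> 1"
    and "gr_sum G X = n"
    and "X \<otimes>\<^bsub>int_group_ring G\<^esub> gr_power G (-1) X = gr_of_int G (n\<^sup>2)"
    and "\<And>q :: nat. prime q \<Longrightarrow> q dvd order G \<Longrightarrow>
           int (ord (int q) t) > max n (n - X \<one>\<^bsub>G\<^esub>) \<or>
           int (ord (int q) t) \<ge> n \<and> even (ord (int q) t)"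
  shows "X = gr_of_int G n"
proof -
  note inv = assms(5) and cond = assms(9)
  interpret finite_comm_group G
    using assms(1,2) by (simp add: finite_comm_group_def finite_comm_group_axioms_def)
  define N where "N = order G"
  have N0: "N > 0" using fin order_gt_0_iff_finite by (auto simp: N_def)
  have tN: "coprime t (int N)" using assms(3) by (simp add: N_def)
  define \<mu> where "\<mu> = (\<lambda>q. Pocklington.ord (int q) t)"
  have cop: "coprime (int q) t" if "q dvd N" for q
    using tN that by (meson coprime_commute coprime_divisors dvd_refl int_dvd_int_iff)
  have \<mu>_ge: "n \<le> int (\<mu> q)" and \<mu>_less: "\<mu> q < q" and odd_q: "odd q"
    if q: "prime q" "q dvd N" for q
  proof -
    show ge: "n \<le> int (\<mu> q)"
      using cond[OF q(1)] q(2) by (auto simp: \<mu>_def N_def)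
    show less: "\<mu> q < q"
      using ord_int_less_prime[OF q(1) cop[OF q(2)]] by (simp add: \<mu>_def)
    show "odd q"
    proof
      \<comment> \<open>For \<open>q = 2\<close> the bounds leave \<open>\<mu> q = n = 1\<close>,
        which is odd and does not exceed \<open>n\<close>, so both alternatives fail.\<close>
      assume "even q"
      then have "q = 2" using q(1) primes_dvd_imp_eq two_is_prime_nat by blast
      then have "\<mu> q = 1" using ge less assms(6) by linarith
      then show False
        using cond[OF q(1)] q(2) assms(6) by (auto simp: \<mu>_def N_def)
    qed
  qed
  have odd_N: "odd N"
    using odd_q[OF two_is_prime_nat] by auto
  have cop2n: "coprime (2 * n) (int N)"
  proof -
    have "coprime n (int N)"
    proof (rule ccontr)
      assume "\<not> coprime n (int N)"
      then have "\<not> coprime (nat n) N"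
        using assms(6) coprime_int_iff[of "nat n" N] by simp
      then have "gcd (nat n) N \<noteq> 1"
        using coprime_iff_gcd_eq_1 by blast
      then obtain p where p: "prime p" "p dvd nat n" "p dvd N"
        using prime_factor_nat[of "gcd (nat n) N"] by (metis gcd_greatest_iff)
      \<comment> \<open>A common prime factor would satisfy p \<le> n \<le> \<mu> p < p.\<close>
      have "p \<le> nat n" using p(2) assms(6) by (intro dvd_imp_le) auto
      then show False using \<mu>_ge[OF p(1,3)] \<mu>_less[OF p(1,3)] assms(6) by linarith
    qed
    then show ?thesis using odd_N by simp
  qed
  define f where "f = (\<lambda>d. gr_power G (int d) X \<one>\<^bsub>G\<^esub>)"
  have unitary: "gr_power G s X \<otimes>\<^bsub>R\<^esub> gr_power G (-1) (gr_power G s X) = gr_of_int G (n\<^sup>2)" for s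
  proof -
    have "gr_power G (-1) (gr_power G s X) = gr_power G s (gr_power G (-1) X)"
      by (simp add: gr_power_gr_power)
    then show ?thesis
      using assms(8) by (simp add: gr_power_of_int flip: gr_power_mult)
  qed
  have sum_n: "gr_sum G (gr_power G s X) = n" for s
    using assms(7) by (simp add: gr_sum_gr_power)
  have f_bounds: "- n < f d" "f d \<le> n" for d
    unfolding f_def using unitary_coeff_one[OF gr_power_closed unitary sum_n assms(6)] by auto
  have f1: "f 1 = X \<one>\<^bsub>G\<^esub>"
    using assms(4) by (simp add: f_def gr_power_one)
  show ?thesis
  proof (cases "X \<one>\<^bsub>G\<^esub> = n")
    case True
    then show ?thesis
      using unitary_coeff_one(3)[OF assms(4,8,7,6)] by simp
  next
    case False
    define m where "m = nat (n - X \<one>\<^bsub>G\<^esub>)"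
    \<comment> \<open>The factor \<open>m div 2\<close> aims at -1 modulo \<open>q\<close>, once
      \<open>m\<close> is known to be the even order \<open>\<mu> q\<close>; the factor
      \<open>N\<close> supplies \<open>q ^ v\<close> for the lift to prime powers and an odd
      cofactor that preserves -1.\<close>
    define u where "u = t ^ ((m div 2) * N)"
    define e where "e = nat (gcd (int N) (u + 1))"
    have e: "int e = gcd (int N) (u + 1)" by (simp add: e_def)
    then have "int e dvd int N" by simp
    then have "e dvd N" by simp
    then obtain d0 where d0: "N = d0 * e" by (metis dvdE mult.commute)
    have fd0: "f d0 = n"
    proof -
      let ?Y = "gr_power G (int d0) X"
      \<comment> \<open>As \<open>N = d0 * e\<close>, the exponents \<open>u * d0\<close> and
        \<open>- d0\<close> agree modulo \<open>N\<close>.\<close>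
      have "int e dvd u + 1" by (simp only: e gcd_dvd2)
      then have "int N dvd int d0 * (u + 1)" by (simp add: d0)
      then have "int (order G) dvd u * int d0 - - int d0"
        by (simp add: N_def algebra_simps)
      then have "gr_power G (- int d0) X = gr_power G (u * int d0) X"
        using gr_power_cong by metis
      also have "\<dots> = gr_power G (int d0) (gr_power G u X)"
        by (simp add: gr_power_gr_power)
      also have "gr_power G u X = X"
        unfolding u_def using assms(4) inv by (rule gr_power_iterate)
      finally have "gr_power G (-1) ?Y = ?Y"
        by (simp add: gr_power_gr_power)
      then have "?Y \<otimes>\<^bsub>R\<^esub> ?Y = gr_of_int G (n\<^sup>2)"
        using unitary[of "int d0"] by (simp only:)
      then have "?Y = gr_of_int G n"
        using square_root_eq_of_int[OF gr_power_closed _ sum_n] cop2n unfolding N_def by blast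
      then show ?thesis by (simp add: f_def gr_of_int_def)
    qed
    define d where "d = (LEAST d. d dvd d0 \<and> f d = n)"
    have d: "d dvd d0" "f d = n"
      using LeastI[of "\<lambda>d. d dvd d0 \<and> f d = n" d0] fd0 by (auto simp: d_def)
    have d_least: "f c \<noteq> n" if "c dvd d0" "c < d" for c
      using not_less_Least[of c "\<lambda>d. d dvd d0 \<and> f d = n"] that by (auto simp: d_def)
    have dN: "d dvd N" using d(1) d0 by simp
    then have dpos: "d > 0" using N0 by (auto intro: Nat.gr0I)
    have step: "int (\<mu> q) dvd f (c * q) - f c" if "prime q" for c q
      unfolding f_def
    proof (rule dvd_gr_power_diff[OF assms(3) inv])
      fix g assume g: "g \<in> carrier G" "g [^]\<^bsub>G\<^esub> (c * q) = \<one>\<^bsub>G\<^esub>" "g [^]\<^bsub>G\<^esub> c \<noteq> \<one>\<^bsub>G\<^esub>"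
      then have "ord g dvd c * q" "\<not> ord g dvd c"
        by (auto simp: pow_eq_id)
      then have "\<not> coprime q (ord g)"
        by (auto simp: coprime_dvd_mult_left_iff coprime_commute)
      then have "q dvd ord g"
        using that prime_imp_coprime by blast
      then show "\<exists>r>0. r dvd ord g \<and> \<mu> q dvd Pocklington.ord (int r) t"
        using prime_gt_0_nat[OF that] by (intro exI[of _ q]) (simp add: \<mu>_def)
    qed simp
    have f_div: "f c = n - int (\<mu> q)" if q: "prime q" and c: "d = c * q" for q c
    proof -
      have qN: "q dvd N" using dN c by (metis dvd_mult_right)
      have "c < d" using c dpos prime_gt_1_nat[OF q] by simp
      moreover have "c dvd d0" using c d(1) by (metis dvd_mult_left)
      ultimately have "f c \<noteq> n" using d_least by blast
      moreover have "int (\<mu> q) dvd n - f c" using step[OF q, of c] c d(2) by simp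
      ultimately have "n - f c = int (\<mu> q)"
        using f_bounds[of c] \<mu>_ge[OF q qN] by (intro multiple_between_eq) auto
      then show ?thesis by simp
    qed
    \<comment> \<open>With \<open>d = c * (p * q)\<close>, the congruence modulo
      \<open>\<mu> p\<close> and the bounds force \<open>f c = f (c * p)\<close>. Comparing
      \<open>f c\<close> with \<open>f (c * q)\<close> modulo \<open>\<mu> q\<close> then makes
      \<open>\<mu> q\<close> divide \<open>\<mu> p\<close>, although \<open>\<mu> p\<close> lies
      strictly between \<open>\<mu> q\<close> and its double.\<close>
    have not_less: "\<not> \<mu> q < \<mu> p" if p: "prime p" "p dvd d" and q: "prime q" "q dvd d" for p q
    proof
      assume less: "\<mu> q < \<mu> p"
      then have "p \<noteq> q" by auto
      then have "p * q dvd d"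
        using p q by (simp add: divides_mult primes_coprime)
      then obtain c where c: "d = c * (p * q)" by (metis dvdE mult.commute)
      have ge: "n \<le> int (\<mu> q)" using \<mu>_ge q dN dvd_trans by blast
      have fp: "f (c * q) = n - int (\<mu> p)" and fq: "f (c * p) = n - int (\<mu> q)"
        using f_div[OF p(1), of "c * q"] f_div[OF q(1), of "c * p"] c by (auto simp: mult_ac)
      have "int (\<mu> p) dvd n - int (\<mu> q) - f c"
        using step[OF p(1), of c] fq by simp
      moreover have "\<bar>n - int (\<mu> q) - f c\<bar> < int (\<mu> p)"
        using f_bounds[of c] less ge by linarith
      ultimately have "f c = n - int (\<mu> q)"
        using dvd_imp_le_int[of "n - int (\<mu> q) - f c" "int (\<mu> p)"] by fastforce
      then have "int (\<mu> q) dvd int (\<mu> q) - int (\<mu> p)"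
        using step[OF q(1), of c] fp by simp
      then have "int (\<mu> q) dvd int (\<mu> p)"
        using dvd_diff[OF dvd_refl] by fastforce
      moreover have "int (\<mu> p) < 2 * int (\<mu> q)"
        using f_bounds(1)[of "c * q"] fp ge by linarith
      ultimately have "int (\<mu> p) = int (\<mu> q)"
        using less by (intro multiple_between_eq) auto
      then show False using less by simp
    qed
    have "d \<noteq> 1" using d(2) f1 False by auto
    then obtain q where q: "prime q" "q dvd d" using prime_factor_nat by blast
    have qN: "q dvd N" using q(2) dN by (rule dvd_trans)
    \<comment> \<open>All primes \<open>r\<close> dividing \<open>d\<close> share the value
      \<open>\<mu> r = \<mu> q\<close>, so one congruence leads from \<open>1\<close> to
      \<open>d\<close> directly.\<close>
    have "int (\<mu> q) dvd f d - f 1"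
      unfolding f_def
    proof (rule dvd_gr_power_diff[OF assms(3) inv])
      fix g assume g: "g \<in> carrier G" "g [^]\<^bsub>G\<^esub> d = \<one>\<^bsub>G\<^esub>" "g [^]\<^bsub>G\<^esub> (1::nat) \<noteq> \<one>\<^bsub>G\<^esub>"
      then have "ord g dvd d" "ord g \<noteq> 1"
        using ord_eq_1[of g] by (simp_all add: pow_eq_id)
      then obtain r where r: "prime r" "r dvd ord g" "r dvd d"
        using prime_factor_nat dvd_trans by blast
      then have "\<mu> r = \<mu> q" using not_less q by (meson linorder_neqE_nat)
      then show "\<exists>r>0. r dvd ord g \<and> \<mu> q dvd Pocklington.ord (int r) t"
        using r prime_gt_0_nat[OF r(1)] by (intro exI[of _ r]) (simp add: \<mu>_def)
    qed simp
    then have "n - X \<one>\<^bsub>G\<^esub> = int (\<mu> q)"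
      using f_bounds[of 1] \<mu>_ge[OF q(1) qN] False d(2)
      unfolding f1 by (intro multiple_between_eq) auto
    then have m: "m = \<mu> q" and even_m: "even m"
      using cond[OF q(1)] qN by (auto simp: m_def \<mu>_def N_def)
    define v where "v = multiplicity q N"
    obtain M where M: "N = q ^ v * M" "\<not> q dvd M"
      using multiplicity_decompose'[of N q] N0 prime_gt_1_nat[OF q(1)] unfolding v_def by auto
    have "odd M" using odd_N M(1) by simp
    define y where "y = (t ^ (m div 2)) ^ (q ^ v)"
    have "int (q ^ Suc v) dvd y + 1"
      unfolding y_def using even_ord_imp_minus_one[OF q(1) cop[OF qN]] even_m
      by (intro prime_power_dvd_lift q odd_q qN) (simp_all add: m \<mu>_def)
    moreover have "y + 1 dvd u + 1"
    proof -
      have "u = y ^ M"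
        unfolding u_def y_def M(1) by (simp only: power_mult mult.assoc)
      \<comment> \<open>Modulo \<open>y + 1\<close>, \<open>y\<close> is -1, and the odd exponent
        \<open>M\<close> keeps the sign.\<close>
      moreover have "[y ^ M = (- 1) ^ M] (mod (y + 1))"
        by (intro cong_pow) (simp add: cong_iff_dvd_diff)
      ultimately show ?thesis
        using \<open>odd M\<close> by (simp add: cong_iff_dvd_diff)
    qed
    ultimately have "int (q ^ Suc v) dvd u + 1" by (rule dvd_trans)
    then have "int (q ^ v) dvd u + 1"
      by (metis dvd_trans int_dvd_int_iff le_imp_power_dvd le_SucI order_refl)
    moreover have "int (q ^ v) dvd int N"
      using M(1) by simp
    ultimately have "int (q ^ v) dvd int e"
      by (simp only: e gcd_greatest)
    then have "q ^ v dvd e" by (simp only: int_dvd_int_iff)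
    \<comment> \<open>Now \<open>N = d0 * e\<close> acquires one factor \<open>q\<close> more than
      its multiplicity \<open>v\<close> allows.\<close>
    moreover have "q dvd d0" using q(2) d(1) by (rule dvd_trans)
    ultimately have "q * q ^ v dvd q ^ v * M"
      unfolding M(1)[symmetric] d0 by (rule mult_dvd_mono[rotated])
    then have "q dvd M"
      using prime_gt_0_nat[OF q(1)] by (simp add: mult.commute)
    with M(2) show ?thesis by simp
  qed
qed

end
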